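(* Let $K$ be an algebraically closed field of characteristic $\ne 2$, $n\ge2$ even, $G=\mathrm{PGL}_n(K)$, and let $D$ be a nontrivial toral elementary abelian $2$-subgroup of $G$ with $C_G(D)=C_G(D)^\circ$. Then $D$ contains an involution not $G$-conjugate to $e_{n/2}$, the image in $G$ of $\mathrm{diag}(-I_{n/2},I_{n/2})$.
   Context: Toral: contained in a maximal torus of $G$. $C_G(D)^\circ$ denotes the identity component of the centralizer. *)

theory Defs
  imports "Jordan_Normal_Form.Determinant" "HOL-Algebra.Group" "HOL-Computational_Algebra.Polynomial"
begin

definition alg_closed_field :: "'a::field itself \<Rightarrow> bool" where
  "alg_closed_field _ \<longleftrightarrow> (\<forall>p :: 'a poly. degree p > 0 \<longrightarrow> (\<exists>x. poly p x = 0))"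

definition GL_set :: "nat \<Rightarrow> 'a::field mat set" where
  "GL_set n = {A \<in> carrier_mat n n. det A \<noteq> 0}"

definition proj_class :: "'a::field mat \<Rightarrow> 'a mat set" where
  "proj_class A = {c \<cdot>\<^sub>m A | c. c \<noteq> 0}"

definition rep_class :: "'a mat set \<Rightarrow> 'a mat" where
  "rep_class P = (SOME A. A \<in> P)"

definition PGL :: "nat \<Rightarrow> ('a::field mat set) monoid" where
  "PGL n = \<lparr> carrier = proj_class ` GL_set n,
             mult = (\<lambda>P Q. proj_class (rep_class P * rep_class Q)),
             one = proj_class (1\<^sub>m n) \<rparr>"

inductive_set poly_fun :: "nat \<Rightarrow> ('a::field mat \<Rightarrow> 'a) set" for n where
  const: "(\<lambda>A. c) \<in> poly_fun n"
| entry: "i < n \<Longrightarrow> j < n \<Longrightarrow> (\<lambda>A. A $$ (i, j)) \<in> poly_fun n"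
| add: "f \<in> poly_fun n \<Longrightarrow> g \<in> poly_fun n \<Longrightarrow> (\<lambda>A. f A + g A) \<in> poly_fun n"
| mult: "f \<in> poly_fun n \<Longrightarrow> g \<in> poly_fun n \<Longrightarrow> (\<lambda>A. f A * g A) \<in> poly_fun n"

text \<open>Zariski-closed subsets of GL_n (the affine variety GL_n; zero sets of f/det^k
  agree with zero sets of f on GL_n).\<close>
definition GL_closed :: "nat \<Rightarrow> 'a::field mat set \<Rightarrow> bool" where
  "GL_closed n S \<longleftrightarrow> (\<exists>F \<subseteq> poly_fun n. S = {A \<in> GL_set n. \<forall>f\<in>F. f A = 0})"

text \<open>Zariski topology of PGL_n = quotient topology of the quotient map GL_n \<rightarrow> PGL_n.\<close>
definition PGL_closed :: "nat \<Rightarrow> 'a::field mat set set \<Rightarrow> bool" where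
  "PGL_closed n C \<longleftrightarrow> C \<subseteq> carrier (PGL n) \<and> GL_closed n (\<Union>C)"

definition PGL_connected :: "nat \<Rightarrow> 'a::field mat set set \<Rightarrow> bool" where
  "PGL_connected n S \<longleftrightarrow> \<not> (\<exists>C1 C2. PGL_closed n C1 \<and> PGL_closed n C2 \<and> S \<subseteq> C1 \<union> C2 \<and>
        C1 \<inter> C2 \<inter> S = {} \<and> C1 \<inter> S \<noteq> {} \<and> C2 \<inter> S \<noteq> {})"

definition PGL_identity_component :: "nat \<Rightarrow> 'a::field mat set set \<Rightarrow> 'a mat set set" where
  "PGL_identity_component n H =
     \<Union>{S. S \<subseteq> H \<and> \<one>\<^bsub>PGL n\<^esub> \<in> S \<and> PGL_connected n S}"

definition PGL_centralizer :: "nat \<Rightarrow> 'a::field mat set set \<Rightarrow> 'a mat set set" where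
  "PGL_centralizer n D = {g \<in> carrier (PGL n). \<forall>d\<in>D. g \<otimes>\<^bsub>PGL n\<^esub> d = d \<otimes>\<^bsub>PGL n\<^esub> g}"

definition PGL_semisimple :: "nat \<Rightarrow> 'a::field mat set \<Rightarrow> bool" where
  "PGL_semisimple n P \<longleftrightarrow> (\<exists>Q \<in> carrier_mat n n. \<exists>R \<in> carrier_mat n n.
      Q * R = 1\<^sub>m n \<and> diagonal_mat (R * rep_class P * Q))"

text \<open>A torus: a closed connected diagonalizable subgroup, i.e. closed, connected,
  commutative and consisting of semisimple elements.\<close>
definition PGL_torus :: "nat \<Rightarrow> 'a::field mat set set \<Rightarrow> bool" where
  "PGL_torus n T \<longleftrightarrow> subgroup T (PGL n) \<and> PGL_closed n T \<and> PGL_connected n T \<and>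
     (\<forall>x\<in>T. \<forall>y\<in>T. x \<otimes>\<^bsub>PGL n\<^esub> y = y \<otimes>\<^bsub>PGL n\<^esub> x) \<and> (\<forall>x\<in>T. PGL_semisimple n x)"

definition PGL_maximal_torus :: "nat \<Rightarrow> 'a::field mat set set \<Rightarrow> bool" where
  "PGL_maximal_torus n T \<longleftrightarrow> PGL_torus n T \<and> (\<forall>T'. PGL_torus n T' \<and> T \<subseteq> T' \<longrightarrow> T' = T)"

definition PGL_toral :: "nat \<Rightarrow> 'a::field mat set set \<Rightarrow> bool" where
  "PGL_toral n D \<longleftrightarrow> (\<exists>T. PGL_maximal_torus n T \<and> D \<subseteq> T)"

definition elem_abelian_2_subgroup :: "('b, 'c) monoid_scheme \<Rightarrow> 'b set \<Rightarrow> bool" where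
  "elem_abelian_2_subgroup G D \<longleftrightarrow> subgroup D G \<and>
     (\<forall>x\<in>D. \<forall>y\<in>D. x \<otimes>\<^bsub>G\<^esub> y = y \<otimes>\<^bsub>G\<^esub> x) \<and> (\<forall>x\<in>D. x \<otimes>\<^bsub>G\<^esub> x = \<one>\<^bsub>G\<^esub>)"

definition conjugate_in :: "('b, 'c) monoid_scheme \<Rightarrow> 'b \<Rightarrow> 'b \<Rightarrow> bool" where
  "conjugate_in G x y \<longleftrightarrow> (\<exists>g\<in>carrier G. g \<otimes>\<^bsub>G\<^esub> x \<otimes>\<^bsub>G\<^esub> inv\<^bsub>G\<^esub> g = y)"

definition e_elem :: "nat \<Rightarrow> nat \<Rightarrow> 'a::field mat set" where
  "e_elem n k = proj_class (mat n n (\<lambda>(i, j). if i = j then (if i < k then -1 else 1) else 0))"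

end

theory Submission
  imports Defs
begin

text \<open>
  Suppose every non-identity element of \<open>D\<close> is conjugate to \<open>e\<^bsub>n/2\<^esub>\<close>; then every element of \<open>D\<close>
  lifts to an involutory matrix. The commutator of lifts with a fixed such lift is a sign, and
  it is constant on connected sets. Applied to a torus containing \<open>D\<close> this shows that the lifts
  of \<open>D\<close> commute, so they are simultaneously diagonal with entries \<open>\<plusminus>1\<close>. The sets of positions
  of the entries \<open>-1\<close> form a binary linear code of length \<open>n\<close> whose words other than \<open>{}\<close> and
  \<open>{..<n}\<close> have weight \<open>n/2\<close>. Twisting by a character that is trivial on these two exceptional
  words does not change the multiplicities of the coordinates, by Fourier inversion, because it
  only affects the contributions of words of weight \<open>n/2\<close>, which vanish. Hence such a twist is
  induced by a permutation of the coordinates. For the quotient of two coordinates that differ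
  on some word, the permutation matrix centralizes \<open>D\<close> but anticommutes with a lift. As the sign
  is constant on connected sets, it is not in the identity component of the centralizer.
\<close>

subsection \<open>Invertible matrices and their projective classes\<close>

lemma one_neq_minus_one_iff: "(1::'a::ring_1) \<noteq> -1 \<longleftrightarrow> (2::'a) \<noteq> 0"
  by (metis add.right_inverse eq_neg_iff_add_eq_0 one_add_one)

lemma smult_smult_mat [simp]: "a \<cdot>\<^sub>m (b \<cdot>\<^sub>m A) = (a * b) \<cdot>\<^sub>m (A :: 'a::semigroup_mult mat)"
  by (intro eq_matI) (auto simp: mult.assoc)

lemma one_smult_mat [simp]: "1 \<cdot>\<^sub>m A = (A :: 'a::monoid_mult mat)"
  by (intro eq_matI) auto

lemmas square_mat_simps =
  assoc_mult_mat[of _ n n _ n _ n] mult_smult_distrib[of _ n n _ n]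
  mult_smult_assoc_mat[of _ n n _ n] mult_carrier_mat[of _ n n _ n] for n

lemma GL_set_carrier: "A \<in> GL_set n \<Longrightarrow> A \<in> carrier_mat n n"
  by (simp add: GL_set_def)

lemma GL_set_mult: "A \<in> GL_set n \<Longrightarrow> B \<in> GL_set n \<Longrightarrow> A * B \<in> GL_set n"
  by (auto simp: GL_set_def det_mult)

lemma GL_set_one: "1\<^sub>m n \<in> GL_set n"
  by (auto simp: GL_set_def)

lemma GL_set_smult: "c \<noteq> 0 \<Longrightarrow> A \<in> GL_set n \<Longrightarrow> c \<cdot>\<^sub>m A \<in> GL_set n"
  by (auto simp: GL_set_def)

lemma GL_setI:
  assumes "A \<in> carrier_mat n n" "B \<in> carrier_mat n n" "A * B = 1\<^sub>m n"
  shows "A \<in> GL_set n"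
proof -
  have "det A * det B = 1" using det_mult[OF assms(1,2)] assms(3) by simp
  then show ?thesis using assms(1) by (auto simp: GL_set_def)
qed

lemma GL_set_inverse:
  assumes "A \<in> GL_set n"
  obtains B where "B \<in> GL_set n" "A * B = 1\<^sub>m n" "B * A = 1\<^sub>m n"
proof -
  have "A \<in> carrier_mat n n" "det A \<noteq> 0" using assms by (auto simp: GL_set_def)
  from det_non_zero_imp_unit[OF this, of "()"] obtain B where
    "B \<in> carrier_mat n n" "B * A = 1\<^sub>m n" "A * B = 1\<^sub>m n"
    unfolding Units_def ring_mat_def by auto
  then show ?thesis using that GL_setI \<open>A \<in> carrier_mat n n\<close> by blast
qed

lemma GL_set_mult_left_cancel:
  assumes P: "P \<in> GL_set n" and AB: "A \<in> carrier_mat n n" "B \<in> carrier_mat n n"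
  shows "P * A = P * B \<longleftrightarrow> A = B"
proof
  assume eq: "P * A = P * B"
  obtain R where "R \<in> GL_set n" "R * P = 1\<^sub>m n" using GL_set_inverse[OF P] by metis
  then show "A = B"
    using arg_cong[OF eq, of "\<lambda>X. R * X"] AB P
    by (simp add: GL_set_carrier flip: assoc_mult_mat[of _ n n _ n _ n])
qed simp

lemma GL_set_mult_right_cancel:
  assumes P: "P \<in> GL_set n" and AB: "A \<in> carrier_mat n n" "B \<in> carrier_mat n n"
  shows "A * P = B * P \<longleftrightarrow> A = B"
proof
  assume eq: "A * P = B * P"
  obtain R where "R \<in> GL_set n" "P * R = 1\<^sub>m n" using GL_set_inverse[OF P] by metis
  then show "A = B"
    using arg_cong[OF eq, of "\<lambda>X. X * R"] AB P
    by (simp add: GL_set_carrier assoc_mult_mat[of _ n n _ n _ n])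
qed simp

lemma GL_set_smult_cancel:
  assumes A: "A \<in> GL_set n" and n: "n > 0"
  shows "c \<cdot>\<^sub>m A = d \<cdot>\<^sub>m A \<longleftrightarrow> c = d"
proof
  assume eq: "c \<cdot>\<^sub>m A = d \<cdot>\<^sub>m A"
  obtain R where R: "R \<in> GL_set n" "A * R = 1\<^sub>m n" using GL_set_inverse[OF A] by metis
  have "c \<cdot>\<^sub>m 1\<^sub>m n = d \<cdot>\<^sub>m (1\<^sub>m n :: 'a mat)"
    using arg_cong[OF eq, of "\<lambda>X. X * R"] R A
    by (simp add: GL_set_carrier square_mat_simps[where n = n])
  then have "(c \<cdot>\<^sub>m 1\<^sub>m n) $$ (0, 0) = (d \<cdot>\<^sub>m 1\<^sub>m n :: 'a mat) $$ (0, 0)" by simp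
  then show "c = d" using n by simp
qed simp

lemma similar_mat_intertwiner:
  fixes A B :: "'a::field mat"
  assumes sim: "similar_mat A B" and A: "A \<in> carrier_mat n n"
  obtains P where "P \<in> GL_set n" "A * P = P * B"
proof -
  obtain P Q where "similar_mat_wit A B P Q" using sim by (auto simp: similar_mat_def)
  note PQ = similar_mat_witD2[OF A this]
  have "P \<in> GL_set n" using PQ by (intro GL_setI[of P n Q])
  moreover have "A * P = P * B * (Q * P)" using PQ by (simp add: square_mat_simps[where n = n])
  then have "A * P = P * B" using PQ by simp
  ultimately show ?thesis by (rule that)
qed

lemma proj_class_self: "A \<in> proj_class A"
  unfolding proj_class_def by (force intro: exI[of _ 1])

lemma proj_class_smult:
  assumes "c \<noteq> 0"
  shows "proj_class (c \<cdot>\<^sub>m A) = proj_class A"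
proof -
  have "\<exists>d. x \<cdot>\<^sub>m A = d \<cdot>\<^sub>m (c \<cdot>\<^sub>m A) \<and> d \<noteq> 0" if "x \<noteq> 0" for x
    using assms that by (intro exI[of _ "x / c"]) simp
  then show ?thesis using assms unfolding proj_class_def by force
qed

lemma proj_class_eq_iff: "proj_class A = proj_class B \<longleftrightarrow> (\<exists>c. c \<noteq> 0 \<and> A = c \<cdot>\<^sub>m B)"
proof
  assume "proj_class A = proj_class B"
  then have "A \<in> proj_class B" using proj_class_self by metis
  then show "\<exists>c. c \<noteq> 0 \<and> A = c \<cdot>\<^sub>m B" unfolding proj_class_def by auto
qed (auto simp: proj_class_smult)

lemma rep_class_proj_class: obtains c where "c \<noteq> 0" "rep_class (proj_class A) = c \<cdot>\<^sub>m A"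
proof -
  have "rep_class (proj_class A) \<in> proj_class A"
    unfolding rep_class_def by (rule someI, rule proj_class_self)
  then show ?thesis using that unfolding proj_class_def by auto
qed

lemma PGL_carrier: "carrier (PGL n) = proj_class ` GL_set n"
  and PGL_one: "\<one>\<^bsub>PGL n\<^esub> = proj_class (1\<^sub>m n)"
  by (simp_all add: PGL_def)

lemma PGL_mult:
  assumes "A \<in> carrier_mat n n" "B \<in> carrier_mat n n"
  shows "proj_class A \<otimes>\<^bsub>PGL n\<^esub> proj_class B = proj_class (A * B)"
proof -
  obtain a where a: "a \<noteq> 0" "rep_class (proj_class A) = a \<cdot>\<^sub>m A" by (rule rep_class_proj_class)
  obtain b where b: "b \<noteq> 0" "rep_class (proj_class B) = b \<cdot>\<^sub>m B" by (rule rep_class_proj_class)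
  have "(a \<cdot>\<^sub>m A) * (b \<cdot>\<^sub>m B) = (b * a) \<cdot>\<^sub>m (A * B)"
    using assms by (simp add: square_mat_simps[where n = n])
  then show ?thesis using a b by (simp add: PGL_def proj_class_smult)
qed

lemma group_PGL: "group (PGL n :: ('a::field mat set) monoid)"
proof (rule groupI)
  fix x y :: "'a mat set" assume "x \<in> carrier (PGL n)" "y \<in> carrier (PGL n)"
  then show "x \<otimes>\<^bsub>PGL n\<^esub> y \<in> carrier (PGL n)"
    by (auto simp: PGL_carrier PGL_mult GL_set_carrier GL_set_mult)
next
  show "\<one>\<^bsub>PGL n\<^esub> \<in> carrier (PGL n :: ('a mat set) monoid)"
    by (simp add: PGL_carrier PGL_one GL_set_one)
next
  fix x y z :: "'a mat set"
  assume "x \<in> carrier (PGL n)" "y \<in> carrier (PGL n)" "z \<in> carrier (PGL n)"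
  then obtain A B C where "A \<in> carrier_mat n n" "B \<in> carrier_mat n n" "C \<in> carrier_mat n n"
    "x = proj_class A" "y = proj_class B" "z = proj_class C"
    unfolding PGL_carrier using GL_set_carrier by blast
  then show "x \<otimes>\<^bsub>PGL n\<^esub> y \<otimes>\<^bsub>PGL n\<^esub> z = x \<otimes>\<^bsub>PGL n\<^esub> (y \<otimes>\<^bsub>PGL n\<^esub> z)"
    by (simp add: PGL_mult[of _ n])
next
  fix x :: "'a mat set" assume "x \<in> carrier (PGL n)"
  then obtain A where A: "A \<in> GL_set n" "x = proj_class A" by (auto simp: PGL_carrier)
  then show "\<one>\<^bsub>PGL n\<^esub> \<otimes>\<^bsub>PGL n\<^esub> x = x"
    using GL_set_carrier[OF A(1)] by (simp add: PGL_one PGL_mult)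
  obtain B where "B \<in> GL_set n" "B * A = 1\<^sub>m n" using GL_set_inverse[OF A(1)] by metis
  then show "\<exists>y\<in>carrier (PGL n). y \<otimes>\<^bsub>PGL n\<^esub> x = \<one>\<^bsub>PGL n\<^esub>"
    using A by (intro bexI[of _ "proj_class B"])
      (auto simp: PGL_carrier PGL_one PGL_mult GL_set_carrier)
qed

lemma PGL_commute_iff:
  assumes "A \<in> GL_set n" "B \<in> GL_set n"
  shows "proj_class A \<otimes>\<^bsub>PGL n\<^esub> proj_class B = proj_class B \<otimes>\<^bsub>PGL n\<^esub> proj_class A
    \<longleftrightarrow> (\<exists>c. c \<noteq> 0 \<and> A * B = c \<cdot>\<^sub>m (B * A))"
  using assms by (simp add: PGL_mult GL_set_carrier proj_class_eq_iff)

lemma conjugate_in_PGL_imp_similar: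
  assumes A: "A \<in> GL_set n" and E: "E \<in> GL_set n"
    and conj: "conjugate_in (PGL n) (proj_class A) (proj_class E)"
  obtains c where "c \<noteq> 0" "similar_mat A (c \<cdot>\<^sub>m E)"
proof -
  interpret group "PGL n" by (rule group_PGL)
  from conj obtain G where G: "G \<in> GL_set n" and
    eq: "proj_class G \<otimes>\<^bsub>PGL n\<^esub> proj_class A \<otimes>\<^bsub>PGL n\<^esub> inv\<^bsub>PGL n\<^esub> proj_class G = proj_class E"
    unfolding conjugate_in_def by (auto simp: PGL_carrier)
  have "proj_class G \<in> carrier (PGL n)" "proj_class A \<in> carrier (PGL n)"
    using G A by (auto simp: PGL_carrier)
  then have "proj_class G \<otimes>\<^bsub>PGL n\<^esub> proj_class A = proj_class E \<otimes>\<^bsub>PGL n\<^esub> proj_class G"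
    unfolding eq[symmetric] by (simp add: m_assoc)
  then obtain c where c: "c \<noteq> 0" "G * A = c \<cdot>\<^sub>m (E * G)"
    using A E G by (auto simp: PGL_mult GL_set_carrier proj_class_eq_iff)
  obtain R where R: "R \<in> GL_set n" "G * R = 1\<^sub>m n" "R * G = 1\<^sub>m n"
    using GL_set_inverse[OF G] by metis
  note carriers = GL_set_carrier[OF A] GL_set_carrier[OF E]
    GL_set_carrier[OF G] GL_set_carrier[OF R(1)]
  have "A = (R * G) * A" using carriers R by simp
  also have "\<dots> = R * (c \<cdot>\<^sub>m (E * G))"
    using carriers c by (simp add: square_mat_simps[where n = n])
  also have "\<dots> = R * (c \<cdot>\<^sub>m E) * G" using carriers by (simp add: square_mat_simps[where n = n])
  finally have "similar_mat A (c \<cdot>\<^sub>m E)"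
    using carriers R by (intro similar_matI[where n = n and P = R and Q = G]) auto
  then show ?thesis using that c by blast
qed

subsection \<open>Scaled commutation on connected subsets\<close>

definition scaled_centralizer :: "nat \<Rightarrow> 'a::field mat \<Rightarrow> 'a \<Rightarrow> 'a mat set" where
  "scaled_centralizer n A c = {B \<in> GL_set n. B * A = c \<cdot>\<^sub>m (A * B)}"

lemma smult_mem_scaled_centralizer:
  assumes "A \<in> carrier_mat n n" "B \<in> scaled_centralizer n A c" "d \<noteq> 0"
  shows "d \<cdot>\<^sub>m B \<in> scaled_centralizer n A c"
proof -
  have "B \<in> GL_set n" "B * A = c \<cdot>\<^sub>m (A * B)"
    using assms(2) by (auto simp: scaled_centralizer_def)
  then show ?thesis
    using assms(1,3) by (simp add: scaled_centralizer_def GL_set_smult GL_set_carrier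
        square_mat_simps[where n = n] mult.commute)
qed

lemma proj_class_mem_scaled_centralizer_iff:
  assumes "A \<in> carrier_mat n n"
  shows "proj_class B \<in> proj_class ` scaled_centralizer n A c \<longleftrightarrow> B \<in> scaled_centralizer n A c"
  using smult_mem_scaled_centralizer[OF assms] by (auto simp: proj_class_eq_iff)

lemma poly_fun_sum:
  "(\<And>k. k \<in> I \<Longrightarrow> f k \<in> poly_fun n) \<Longrightarrow> (\<lambda>A. \<Sum>k\<in>I. f k A) \<in> poly_fun n"
proof (induction I rule: infinite_finite_induct)
  case (insert x F)
  then show ?case using poly_fun.add[of "f x" n "\<lambda>A. \<Sum>k\<in>F. f k A"] by simp
qed (simp_all add: poly_fun.const)

lemma GL_closed_scaled_centralizer:
  fixes A :: "'a::field mat"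
  assumes A: "A \<in> carrier_mat n n"
  shows "GL_closed n (scaled_centralizer n A c)"
proof -
  define f where "f = (\<lambda>(i, j) B.
    (\<Sum>k<n. B $$ (i, k) * A $$ (k, j)) + (-c) * (\<Sum>k<n. A $$ (i, k) * B $$ (k, j)))"
  have f: "f (i, j) \<in> poly_fun n" if "i < n" "j < n" for i j
    unfolding f_def prod.case using that
    by (intro poly_fun.add poly_fun.mult poly_fun_sum poly_fun.const poly_fun.entry) auto
  have f_eq: "f (i, j) B = (B * A) $$ (i, j) - (c \<cdot>\<^sub>m (A * B)) $$ (i, j)"
    if "i < n" "j < n" "B \<in> carrier_mat n n" for i j B
    using that A by (simp add: f_def scalar_prod_def atLeast0LessThan)
  have "B * A = c \<cdot>\<^sub>m (A * B) \<longleftrightarrow> (\<forall>g \<in> f ` ({..<n} \<times> {..<n}). g B = 0)" if "B \<in> GL_set n" for B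
    using A GL_set_carrier[OF that] by (auto simp: f_eq mat_eq_iff)
  then have "scaled_centralizer n A c = {B \<in> GL_set n. \<forall>g \<in> f ` ({..<n} \<times> {..<n}). g B = 0}"
    unfolding scaled_centralizer_def by blast
  then show ?thesis
    unfolding GL_closed_def using f by (intro exI[of _ "f ` ({..<n} \<times> {..<n})"]) auto
qed

lemma PGL_closed_scaled_centralizer:
  assumes A: "A \<in> carrier_mat n n"
  shows "PGL_closed n (proj_class ` scaled_centralizer n A c)"
proof -
  have "\<Union>(proj_class ` scaled_centralizer n A c) = scaled_centralizer n A c"
    using smult_mem_scaled_centralizer[OF A] proj_class_self by (force simp: proj_class_def)
  moreover have "scaled_centralizer n A c \<subseteq> GL_set n" by (auto simp: scaled_centralizer_def)
  ultimately show ?thesis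
    using GL_closed_scaled_centralizer[OF A] by (auto simp: PGL_closed_def PGL_carrier)
qed

lemma proj_class_scaled_centralizer_disjoint:
  assumes A: "A \<in> GL_set n" and n: "n > 0" and "c \<noteq> d"
  shows "proj_class ` scaled_centralizer n A c \<inter> proj_class ` scaled_centralizer n A d = {}"
proof -
  have "B \<notin> scaled_centralizer n A d" if "B \<in> scaled_centralizer n A c" for B
    using that \<open>c \<noteq> d\<close> GL_set_smult_cancel[OF GL_set_mult[OF A] n]
    by (auto simp: scaled_centralizer_def)
  then show ?thesis
    using proj_class_mem_scaled_centralizer_iff[OF GL_set_carrier[OF A]] by blast
qed

lemma scaled_centralizer_involution:
  assumes A: "A \<in> carrier_mat n n" "A * A = 1\<^sub>m n" and n: "n > 0"
    and B: "B \<in> scaled_centralizer n A c"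
  shows "c = 1 \<or> c = -1"
proof -
  have GL_B: "B \<in> GL_set n" and comm: "B * A = c \<cdot>\<^sub>m (A * B)"
    using B by (auto simp: scaled_centralizer_def)
  note carriers = A(1) GL_set_carrier[OF GL_B]
  have "1 \<cdot>\<^sub>m B = B * (A * A)" using A carriers by simp
  also have "\<dots> = (B * A) * A" using carriers by simp
  also have "\<dots> = (c \<cdot>\<^sub>m (A * B)) * A" by (simp only: comm)
  also have "\<dots> = c \<cdot>\<^sub>m (A * (B * A))" using carriers by (simp add: square_mat_simps[where n = n])
  also have "\<dots> = (c * c) \<cdot>\<^sub>m ((A * A) * B)"
    unfolding comm using carriers by (simp add: square_mat_simps[where n = n])
  finally have "c * c = 1" using carriers A GL_set_smult_cancel[OF GL_B n, of "c * c" 1] by simp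
  then show ?thesis by (simp add: square_eq_1_iff)
qed

lemma PGL_connected_subset_closed:
  assumes "PGL_connected n S" "PGL_closed n C1" "PGL_closed n C2" "S \<subseteq> C1 \<union> C2"
    and "C1 \<inter> C2 \<inter> S = {}" "C1 \<inter> S \<noteq> {}"
  shows "S \<subseteq> C1"
  using assms unfolding PGL_connected_def by blast

text \<open>The commutator of a fixed involutory matrix with the lifts of a class is a sign that depends
  continuously on the class, hence is constant on connected sets.\<close>

lemma PGL_connected_commuting_lifts:
  fixes A :: "'a::field mat"
  assumes char: "(2::'a) \<noteq> 0" and n: "n > 0"
    and S: "PGL_connected n S" "S \<subseteq> PGL_centralizer n {proj_class A}" "\<one>\<^bsub>PGL n\<^esub> \<in> S"
    and A: "A \<in> GL_set n" "A * A = 1\<^sub>m n"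
    and B: "B \<in> carrier_mat n n" "proj_class B \<in> S"
  shows "B * A = A * B"
proof -
  note carrier_A = GL_set_carrier[OF A(1)]
  let ?C = "\<lambda>c. proj_class ` scaled_centralizer n A c"
  have "S \<subseteq> ?C 1 \<union> ?C (-1)"
  proof
    fix x assume "x \<in> S"
    then have "x \<in> carrier (PGL n)" "x \<otimes>\<^bsub>PGL n\<^esub> proj_class A = proj_class A \<otimes>\<^bsub>PGL n\<^esub> x"
      using S(2) by (auto simp: PGL_centralizer_def)
    then obtain X c where X: "X \<in> GL_set n" "x = proj_class X" "X * A = c \<cdot>\<^sub>m (A * X)"
      using PGL_commute_iff[OF _ A(1)] unfolding PGL_carrier by blast
    then have "X \<in> scaled_centralizer n A c" by (simp add: scaled_centralizer_def)
    then show "x \<in> ?C 1 \<union> ?C (-1)"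
      using scaled_centralizer_involution[OF carrier_A A(2) n, of X c] X(2) by auto
  qed
  moreover have "?C 1 \<inter> ?C (-1) = {}"
    using one_neq_minus_one_iff char
    by (intro proj_class_scaled_centralizer_disjoint[OF A(1) n]) blast
  moreover have "\<one>\<^bsub>PGL n\<^esub> \<in> ?C 1"
    using carrier_A by (auto simp: PGL_one scaled_centralizer_def GL_set_one)
  ultimately have "S \<subseteq> ?C 1"
    using S(3) by (intro PGL_connected_subset_closed[OF S(1), of "?C 1" "?C (-1)"]
        PGL_closed_scaled_centralizer[OF carrier_A]) auto
  then have "B \<in> scaled_centralizer n A 1"
    using B(2) proj_class_mem_scaled_centralizer_iff[OF carrier_A] by blast
  then show ?thesis by (simp add: scaled_centralizer_def)
qed

subsection \<open>Binary codes and their characters\<close>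

definition bool_sign :: "bool \<Rightarrow> 'a::ring_1" where
  "bool_sign b = (if b then -1 else 1)"

lemma bool_sign_simps [simp]: "bool_sign True = -1" "bool_sign False = 1"
  by (simp_all add: bool_sign_def)

lemma bool_sign_neq: "bool_sign (p \<noteq> q) = bool_sign p * bool_sign q"
  by (simp add: bool_sign_def)

lemma bool_sign_square [simp]: "bool_sign p * bool_sign p = 1"
  by (simp add: bool_sign_def)

lemma bool_sign_nonzero: "bool_sign p \<noteq> 0"
  by (simp add: bool_sign_def)

lemma bool_sign_eq_iff:
  assumes "(2::'a::ring_1) \<noteq> 0"
  shows "(bool_sign p :: 'a) = bool_sign q \<longleftrightarrow> p = q"
  using one_neq_minus_one_iff[where 'a = 'a] assms by (auto simp: bool_sign_def)

definition sym_diff_closed :: "'a set set \<Rightarrow> bool" where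
  "sym_diff_closed F \<longleftrightarrow> (\<forall>S\<in>F. \<forall>T\<in>F. sym_diff S T \<in> F)"

definition parity_character :: "'a set set \<Rightarrow> ('a set \<Rightarrow> bool) \<Rightarrow> bool" where
  "parity_character F l \<longleftrightarrow> (\<forall>S\<in>F. \<forall>T\<in>F. l (sym_diff S T) \<longleftrightarrow> l S \<noteq> l T)"

lemma parity_character_mem: "parity_character F (\<lambda>S. i \<in> S)"
  by (auto simp: parity_character_def)

lemma parity_character_neq:
  assumes "parity_character F k" "parity_character F l"
  shows "parity_character F (\<lambda>S. k S \<noteq> l S)"
  using assms unfolding parity_character_def by blast

lemma sum_parity_character:
  assumes F: "sym_diff_closed F" and l: "parity_character F l" and B: "B \<in> F" "l B"
  shows "(\<Sum>S\<in>F. bool_sign (l S)) = (0::int)"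
proof -
  have "(\<Sum>S\<in>F. bool_sign (l S)) = (\<Sum>S\<in>F. bool_sign (l (sym_diff B S)) :: int)"
  proof (rule sum.reindex_bij_witness[where i = "sym_diff B" and j = "sym_diff B"])
    show "sym_diff B (sym_diff B S) = S" for S by auto
    then show "bool_sign (l (sym_diff B (sym_diff B S))) = (bool_sign (l S) :: int)" for S by simp
  qed (use F B in \<open>auto simp: sym_diff_closed_def\<close>)
  also have "\<dots> = (\<Sum>S\<in>F. - bool_sign (l S))"
    using B l by (intro sum.cong) (auto simp: parity_character_def bool_sign_def)
  finally show ?thesis by (simp add: sum_negf)
qed

definition coordinates_with_character :: "'a set \<Rightarrow> 'a set set \<Rightarrow> ('a set \<Rightarrow> bool) \<Rightarrow> 'a set" where
  "coordinates_with_character I F l = {i\<in>I. \<forall>S\<in>F. i \<in> S \<longleftrightarrow> l S}"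

lemma sum_bool_sign_mem:
  assumes "finite I" "S \<subseteq> I"
  shows "(\<Sum>i\<in>I. bool_sign (i \<in> S)) = int (card I) - 2 * int (card S)"
proof -
  have "(\<Sum>i\<in>I. bool_sign (i \<in> S) :: int) = (\<Sum>i\<in>I. 1 - 2 * of_bool (i \<in> S))"
    by (intro sum.cong) (auto simp: bool_sign_def)
  also have "\<dots> = int (card I) - 2 * int (card (I \<inter> S))"
    using assms by (simp add: sum_subtractf sum_of_bool_eq flip: sum_distrib_left)
  finally show ?thesis using assms by (simp add: Int_absorb1)
qed

text \<open>Fourier inversion on the code: the multiplicity of a character among the coordinates is
  determined by the weights of the code words.\<close>

lemma card_coordinates_with_character:
  assumes I: "finite I" and F: "F \<subseteq> Pow I" "sym_diff_closed F" and l: "parity_character F l"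
  shows "int (card (coordinates_with_character I F l) * card F)
    = (\<Sum>S\<in>F. bool_sign (l S) * (int (card I) - 2 * int (card S)))"
proof -
  have inner: "(\<Sum>S\<in>F. bool_sign (l S) * bool_sign (i \<in> S))
      = (if i \<in> coordinates_with_character I F l then int (card F) else 0)" if "i \<in> I" for i
  proof (cases "\<forall>S\<in>F. i \<in> S \<longleftrightarrow> l S")
    case True
    then show ?thesis using that by (simp add: coordinates_with_character_def)
  next
    case False
    then obtain B where "B \<in> F" "l B \<noteq> (i \<in> B)" by blast
    from sum_parity_character[OF F(2) parity_character_neq[OF l parity_character_mem] this]
    have "(\<Sum>S\<in>F. bool_sign (l S) * bool_sign (i \<in> S)) = (0::int)" by (simp only: bool_sign_neq)
    then show ?thesis using False by (simp only: coordinates_with_character_def) auto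
  qed
  have "int (card (coordinates_with_character I F l) * card F)
      = (\<Sum>i\<in>I. if i \<in> coordinates_with_character I F l then int (card F) else 0)"
    using I by (simp add: sum.If_cases Int_def coordinates_with_character_def)
  also have "\<dots> = (\<Sum>i\<in>I. \<Sum>S\<in>F. bool_sign (l S) * bool_sign (i \<in> S))"
    by (intro sum.cong refl) (simp only: inner)
  also have "\<dots> = (\<Sum>S\<in>F. bool_sign (l S) * (\<Sum>i\<in>I. bool_sign (i \<in> S)))"
    by (subst sum.swap) (simp add: sum_distrib_left)
  also have "\<dots> = (\<Sum>S\<in>F. bool_sign (l S) * (int (card I) - 2 * int (card S)))"
    using F I by (intro sum.cong refl arg_cong2[where f = "(*)"] sum_bool_sign_mem) auto
  finally show ?thesis .
qed

lemma card_coordinates_with_character_translate: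
  assumes I: "finite I" and F: "F \<subseteq> Pow I" "sym_diff_closed F"
    and k: "parity_character F k" and l: "parity_character F l"
    and balanced: "\<And>S. S \<in> F \<Longrightarrow> l S \<Longrightarrow> 2 * card S = card I"
  shows "card (coordinates_with_character I F (\<lambda>S. k S \<noteq> l S))
    = card (coordinates_with_character I F k)"
proof (cases "F = {}")
  case True
  then show ?thesis by (simp add: coordinates_with_character_def)
next
  case False
  have "bool_sign (k S \<noteq> l S) * (int (card I) - 2 * int (card S))
      = bool_sign (k S) * (int (card I) - 2 * int (card S))" if "S \<in> F" for S
    using balanced[OF that] by (cases "l S") (auto simp: bool_sign_neq)
  then have "int (card (coordinates_with_character I F (\<lambda>S. k S \<noteq> l S)) * card F)
      = int (card (coordinates_with_character I F k) * card F)"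
    unfolding card_coordinates_with_character[OF I F parity_character_neq[OF k l]]
      card_coordinates_with_character[OF I F k]
    by (intro sum.cong) auto
  moreover have "card F > 0"
    using False I F(1) finite_subset card_gt_0_iff by blast
  ultimately show ?thesis by (simp flip: of_nat_mult)
qed

lemma code_translation_permutation:
  assumes I: "finite I" and F: "F \<subseteq> Pow I" "sym_diff_closed F" and l: "parity_character F l"
    and balanced: "\<And>S. S \<in> F \<Longrightarrow> l S \<Longrightarrow> 2 * card S = card I"
  obtains p where "p permutes I" and "\<And>i S. i \<in> I \<Longrightarrow> S \<in> F \<Longrightarrow> p i \<in> S \<longleftrightarrow> (i \<in> S) \<noteq> l S"
proof -
  define words where "words i = {S\<in>F. i \<in> S}" for i
  define twisted_words where "twisted_words i = {S\<in>F. (i \<in> S) \<noteq> l S}" for i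
  have "card {i\<in>I. twisted_words i = K} = card {i\<in>I. words i = K}" for K
  proof (cases "K \<subseteq> F \<and> parity_character F (\<lambda>S. S \<in> K)")
    case True
    then have "{i\<in>I. twisted_words i = K} = coordinates_with_character I F (\<lambda>S. (S \<in> K) \<noteq> l S)"
      and "{i\<in>I. words i = K} = coordinates_with_character I F (\<lambda>S. S \<in> K)"
      by (auto simp: twisted_words_def words_def coordinates_with_character_def)
    then show ?thesis
      using card_coordinates_with_character_translate[OF I F _ l balanced] True by simp
  next
    case False
    have "parity_character F (\<lambda>S. S \<in> words i)"
      and "parity_character F (\<lambda>S. S \<in> twisted_words i)" for i
      using parity_character_mem[of F i]
        parity_character_neq[OF parity_character_mem l, of i] F(2)
      by (auto simp: parity_character_def sym_diff_closed_def words_def twisted_words_def)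
    then have "{i\<in>I. twisted_words i = K} = {}" "{i\<in>I. words i = K} = {}"
      using False by (auto simp: words_def twisted_words_def)
    then show ?thesis by (simp only:)
  qed
  then have "image_mset twisted_words (mset_set I) = image_mset words (mset_set I)"
    using I by (intro multiset_eqI) (simp add: count_image_mset' eq_commute)
  then obtain p where p: "p permutes I" "\<forall>i\<in>I. twisted_words i = words (p i)"
    by (rule image_mset_eq_implies_permutes[OF I])
  show ?thesis
  proof (rule that[OF p(1)])
    fix i S assume "i \<in> I" "S \<in> F"
    moreover from this p(2) have "S \<in> twisted_words i \<longleftrightarrow> S \<in> words (p i)" by blast
    ultimately show "p i \<in> S \<longleftrightarrow> (i \<in> S) \<noteq> l S" by (simp add: words_def twisted_words_def)
  qed
qed

subsection \<open>Commuting involutory matrices\<close>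

definition sign_mat :: "nat \<Rightarrow> nat set \<Rightarrow> 'a::comm_ring_1 mat" where
  "sign_mat n S = mat_diag n (\<lambda>i. bool_sign (i \<in> S))"

lemma sign_mat_carrier [simp]: "sign_mat n S \<in> carrier_mat n n"
  by (simp add: sign_mat_def)

lemma sign_mat_dim [simp]: "dim_row (sign_mat n S) = n" "dim_col (sign_mat n S) = n"
  using sign_mat_carrier by blast+

lemma index_mult_sign_mat:
  assumes "A \<in> carrier_mat n n" "i < n" "j < n"
  shows "(A * sign_mat n S) $$ (i, j) = A $$ (i, j) * bool_sign (j \<in> S)"
    and "(sign_mat n S * A) $$ (i, j) = bool_sign (i \<in> S) * A $$ (i, j)"
  using assms by (simp_all add: sign_mat_def mat_diag_mult_left mat_diag_mult_right)

lemma sign_mat_mult: "sign_mat n S * sign_mat n T = sign_mat n (sym_diff S T)"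
proof -
  have "bool_sign (i \<in> S) * bool_sign (i \<in> T) = (bool_sign (i \<in> sym_diff S T) :: 'a)" for i
    by (auto simp: bool_sign_def)
  then show ?thesis by (simp add: sign_mat_def)
qed

lemma sign_mat_empty: "sign_mat n {} = 1\<^sub>m n"
  by (simp add: sign_mat_def)

lemma sign_mat_full: "sign_mat n {..<n} = (-1) \<cdot>\<^sub>m 1\<^sub>m n"
  by (intro eq_matI) (auto simp: sign_mat_def mat_diag_def)

lemma sign_mat_square: "sign_mat n S * sign_mat n S = 1\<^sub>m n"
  by (simp add: sign_mat_mult sign_mat_empty)

lemma sign_mat_GL: "sign_mat n S \<in> GL_set n"
  by (rule GL_setI[OF _ _ sign_mat_square]) auto

lemma sign_mat_eq_smult_one_imp:
  assumes char: "(2::'a::field) \<noteq> 0" and S: "S \<subseteq> {..<n}"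
    and eq: "sign_mat n S = c \<cdot>\<^sub>m (1\<^sub>m n :: 'a mat)"
  shows "S = {} \<or> S = {..<n}"
proof -
  have entry: "(bool_sign (i \<in> S) :: 'a) = c" if "i < n" for i
    using arg_cong[OF eq, of "\<lambda>M. M $$ (i, i)"] that by (simp add: sign_mat_def mat_diag_def)
  have "i \<in> S \<longleftrightarrow> j \<in> S" if "i < n" "j < n" for i j
    using entry[OF that(1)] entry[OF that(2)] bool_sign_eq_iff[OF char] by metis
  then show ?thesis using S by blast
qed

lemma GL_set_ex_permutation:
  assumes "P \<in> GL_set n"
  obtains p where "p permutes {..<n}" "\<And>i. i < n \<Longrightarrow> P $$ (i, p i) \<noteq> 0"
proof -
  have "(\<Sum>p | p permutes {0..<n}. signof p * (\<Prod>i = 0..<n. P $$ (i, p i))) \<noteq> 0"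
    using assms det_def'[of P n] by (simp add: GL_set_def)
  then obtain p where "p \<in> {p. p permutes {0..<n}}" "signof p * (\<Prod>i = 0..<n. P $$ (i, p i)) \<noteq> 0"
    by (rule sum.not_neutral_contains_not_neutral)
  then show ?thesis using that[of p] by (simp add: atLeast0LessThan)
qed

lemma card_permutes_preimage:
  assumes p: "p permutes I" and U: "U \<subseteq> I"
  shows "card {i\<in>I. p i \<in> U} = card U"
proof -
  have "p ` {i\<in>I. p i \<in> U} = U" using permutes_image[OF p] U by auto
  then show ?thesis using card_image[OF permutes_inj_on[OF p], of "{i\<in>I. p i \<in> U}"] by simp
qed

text \<open>Some term of the Leibniz expansion of the determinant of the intertwining matrix is nonzero,
  and its permutation matches the diagonal entries of the two sign matrices.\<close>

lemma similar_sign_mat_ex_permutation: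
  fixes c :: "'a::field"
  assumes sim: "similar_mat (sign_mat n S) (c \<cdot>\<^sub>m sign_mat n T)"
  obtains p where "p permutes {..<n}"
    and "\<And>i. i < n \<Longrightarrow> bool_sign (i \<in> S) = c * bool_sign (p i \<in> T)"
proof -
  obtain P where P: "P \<in> GL_set n" and "sign_mat n S * P = P * (c \<cdot>\<^sub>m sign_mat n T)"
    by (rule similar_mat_intertwiner[OF sim sign_mat_carrier])
  then have eq: "sign_mat n S * P = c \<cdot>\<^sub>m (P * sign_mat n T)"
    by (simp add: GL_set_carrier square_mat_simps[where n = n])
  obtain p where p: "p permutes {..<n}" and nonzero: "\<And>i. i < n \<Longrightarrow> P $$ (i, p i) \<noteq> 0"
    by (rule GL_set_ex_permutation[OF P]) blast
  have "bool_sign (i \<in> S) = c * bool_sign (p i \<in> T)" if i: "i < n" for i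
  proof -
    have "p i < n" using permutes_in_image[OF p, of i] i by simp
    then have "bool_sign (i \<in> S) * P $$ (i, p i) = c * bool_sign (p i \<in> T) * P $$ (i, p i)"
      using arg_cong[OF eq, of "\<lambda>M. M $$ (i, p i)"] i GL_set_carrier[OF P]
      by (simp add: index_mult_sign_mat mult_ac del: index_mult_mat(1))
    then show ?thesis using nonzero[OF i] by simp
  qed
  then show ?thesis using that p by blast
qed

lemma similar_sign_mat_card:
  fixes c :: "'a::field"
  assumes char: "(2::'a) \<noteq> 0" and ST: "S \<subseteq> {..<n}" "T \<subseteq> {..<n}"
    and sim: "similar_mat (sign_mat n S) (c \<cdot>\<^sub>m sign_mat n T)"
  shows "card S = card T \<or> card S = n - card T"
proof -
  obtain p where p: "p permutes {..<n}"
    and entry: "\<And>i. i < n \<Longrightarrow> bool_sign (i \<in> S) = c * bool_sign (p i \<in> T)"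
    by (rule similar_sign_mat_ex_permutation[OF sim]) blast
  consider "n = 0" | "c = 1" | "c = -1"
  proof (cases "n = 0")
    case False
    then show thesis
      using entry[of 0] that
      by (cases "0 \<in> S"; cases "p 0 \<in> T") (auto simp: minus_equation_iff[of c])
  qed (use that in blast)
  then show ?thesis
  proof cases
    case 1
    then show ?thesis using ST by simp
  next
    case 2
    then have "S = {i\<in>{..<n}. p i \<in> T}"
      using ST(1) entry bool_sign_eq_iff[OF char] by auto
    then show ?thesis using card_permutes_preimage[OF p ST(2)] by simp
  next
    case 3
    have "bool_sign (i \<in> S) = (bool_sign (p i \<in> {..<n} - T) :: 'a)" if "i < n" for i
      using entry[OF that] permutes_in_image[OF p, of i] that 3 by (simp add: bool_sign_def)
    then have "S = {i\<in>{..<n}. p i \<in> {..<n} - T}"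
      using ST(1) bool_sign_eq_iff[OF char] by auto
    then show ?thesis
      using card_permutes_preimage[OF p, of "{..<n} - T"] ST(2)
      by (simp add: card_Diff_subset finite_subset)
  qed
qed

definition projectively_balanced :: "nat \<Rightarrow> 'a::field mat \<Rightarrow> bool" where
  "projectively_balanced n A \<longleftrightarrow>
    (\<exists>T c. T \<subseteq> {..<n} \<and> 2 * card T = n \<and> similar_mat A (c \<cdot>\<^sub>m sign_mat n T))"

lemma projectively_balanced_card:
  fixes A :: "'a::field mat"
  assumes char: "(2::'a) \<noteq> 0" and A: "A \<in> carrier_mat n n" "projectively_balanced n A"
    and P: "P \<in> GL_set n" and S: "S \<subseteq> {..<n}" and diag: "A * P = P * sign_mat n S"
  shows "2 * card S = n"
proof -
  obtain T c where T: "T \<subseteq> {..<n}" "2 * card T = n" and c: "similar_mat A (c \<cdot>\<^sub>m sign_mat n T)"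
    using A(2) by (auto simp: projectively_balanced_def)
  obtain R where R: "R \<in> GL_set n" "P * R = 1\<^sub>m n" "R * P = 1\<^sub>m n"
    using GL_set_inverse[OF P] by metis
  note carriers = A(1) GL_set_carrier[OF P] GL_set_carrier[OF R(1)]
  have "sign_mat n S = R * P * sign_mat n S"
    unfolding R(3) by (simp add: left_mult_one_mat[of _ n n])
  also have "\<dots> = R * (A * P)"
    unfolding diag using carriers by (simp add: square_mat_simps[where n = n])
  also have "\<dots> = R * A * P" using carriers by (simp add: square_mat_simps[where n = n])
  finally have "similar_mat (sign_mat n S) A"
    using carriers R by (intro similar_matI[where n = n and P = R and Q = P]) auto
  then have "card S = card T \<or> card S = n - card T"
    by (intro similar_sign_mat_card[OF char S T(1)]) (rule similar_mat_trans[OF _ c])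
  then show ?thesis using T(2) by auto
qed

definition commuting_involutions :: "nat \<Rightarrow> 'a::field mat set \<Rightarrow> bool" where
  "commuting_involutions n L \<longleftrightarrow>
    (\<forall>A\<in>L. A \<in> carrier_mat n n \<and> A * A = 1\<^sub>m n) \<and> (\<forall>A\<in>L. \<forall>B\<in>L. A * B = B * A)"

lemma commuting_involutions_subset:
  "commuting_involutions n L \<Longrightarrow> M \<subseteq> L \<Longrightarrow> commuting_involutions n M"
  unfolding commuting_involutions_def by blast

definition sign_eigenvector :: "'a::comm_ring_1 mat \<Rightarrow> 'a vec \<Rightarrow> bool" where
  "sign_eigenvector X w \<longleftrightarrow> (\<exists>e\<in>{1, -1}. X *\<^sub>v w = e \<cdot>\<^sub>v w)"

lemma sign_eigenvector_add_smult_image: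
  fixes X :: "'a::field mat"
  assumes X: "X \<in> carrier_mat n n" "X * X = 1\<^sub>m n" and w: "w \<in> carrier_vec n"
    and e: "e = 1 \<or> e = -1"
  shows "sign_eigenvector X (w + e \<cdot>\<^sub>v (X *\<^sub>v w))"
proof -
  have "X *\<^sub>v (X *\<^sub>v w) = w" using X w by (simp flip: assoc_mult_mat_vec)
  then have "X *\<^sub>v (w + e \<cdot>\<^sub>v (X *\<^sub>v w)) = X *\<^sub>v w + e \<cdot>\<^sub>v w"
    using X w by (simp add: mult_add_distrib_mat_vec[of _ n n] mult_mat_vec[of _ n n])
  also have "\<dots> = e \<cdot>\<^sub>v (w + e \<cdot>\<^sub>v (X *\<^sub>v w))"
    using X w e
    by (auto simp: smult_add_distrib_vec[of _ n] smult_smult_assoc comm_add_vec[of w n])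
  finally show ?thesis using e unfolding sign_eigenvector_def by blast
qed

lemma sign_eigenvector_add_smult_commuting_image:
  fixes X Y :: "'a::field mat"
  assumes XY: "X \<in> carrier_mat n n" "Y \<in> carrier_mat n n" "Y * X = X * Y"
    and w: "w \<in> carrier_vec n" and eig: "sign_eigenvector Y w"
  shows "sign_eigenvector Y (w + e \<cdot>\<^sub>v (X *\<^sub>v w))"
proof -
  obtain d where d: "d \<in> {1, -1}" "Y *\<^sub>v w = d \<cdot>\<^sub>v w"
    using eig unfolding sign_eigenvector_def by blast
  have "Y *\<^sub>v (X *\<^sub>v w) = (X * Y) *\<^sub>v w" using XY w by (simp flip: XY(3))
  also have "\<dots> = d \<cdot>\<^sub>v (X *\<^sub>v w)" using XY w d by (simp add: mult_mat_vec[of _ n n])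
  finally have "Y *\<^sub>v (w + e \<cdot>\<^sub>v (X *\<^sub>v w)) = d \<cdot>\<^sub>v (w + e \<cdot>\<^sub>v (X *\<^sub>v w))"
    using XY w d(2)
    by (simp add: mult_add_distrib_mat_vec[of _ n n] mult_mat_vec[of _ n n]
        smult_add_distrib_vec[of _ n] smult_smult_assoc mult.commute)
  then show ?thesis using d(1) unfolding sign_eigenvector_def by blast
qed

text \<open>A common eigenvector \<open>w\<close> is replaced by \<open>w + X w\<close> or \<open>w - X w\<close> when one more involution \<open>X\<close>
  is added; these add up to \<open>2 w\<close>, so the functional \<open>r\<close> does not vanish on both.\<close>

lemma commuting_involutions_common_eigenvector:
  fixes L :: "'a::field mat set"
  assumes char: "(2::'a) \<noteq> 0" and "finite L" "commuting_involutions n L"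
    and r: "r \<in> carrier_vec n" and v: "v \<in> carrier_vec n" "r \<bullet> v \<noteq> 0"
  obtains w where "w \<in> carrier_vec n" "r \<bullet> w \<noteq> 0" and "\<And>X. X \<in> L \<Longrightarrow> sign_eigenvector X w"
  using assms(2,3)
proof (induction L arbitrary: thesis)
  case empty
  then show ?case using v by blast
next
  case (insert X L)
  have "commuting_involutions n L"
    using commuting_involutions_subset[OF insert.prems(2)] by blast
  with insert.IH obtain w where w: "w \<in> carrier_vec n" "r \<bullet> w \<noteq> 0"
    and eig: "\<And>Y. Y \<in> L \<Longrightarrow> sign_eigenvector Y w" by blast
  have X: "X \<in> carrier_mat n n" "X * X = 1\<^sub>m n"
    using insert.prems by (auto simp: commuting_involutions_def)
  let ?u = "\<lambda>e. w + e \<cdot>\<^sub>v (X *\<^sub>v w)"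
  have "r \<bullet> ?u 1 + r \<bullet> ?u (-1) = 2 * (r \<bullet> w)"
    using r w X by (simp add: scalar_prod_add_distrib[of _ n])
  then obtain e where e: "e = 1 \<or> e = -1" "r \<bullet> ?u e \<noteq> 0"
    using w(2) char by (metis add.right_neutral mult_eq_0_iff)
  have "sign_eigenvector Y (?u e)" if Y: "Y \<in> insert X L" for Y
  proof (cases "Y = X")
    case True
    then show ?thesis using sign_eigenvector_add_smult_image[OF X w(1) e(1)] by simp
  next
    case False
    then have "Y \<in> L" using Y by blast
    moreover have "Y \<in> carrier_mat n n" "Y * X = X * Y"
      using Y insert.prems(2) by (auto simp: commuting_involutions_def)
    ultimately show ?thesis
      using X(1) w(1) eig by (intro sign_eigenvector_add_smult_commuting_image)
  qed
  moreover have "?u e \<in> carrier_vec n" using X w by simp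
  ultimately show ?case using insert.prems(1)[of "?u e"] e(2) by simp
qed

lemma replace_col_carrier [simp]: "P \<in> carrier_mat n m \<Longrightarrow> replace_col P w j \<in> carrier_mat n m"
  by (simp add: replace_col_def)

lemma col_replace_col:
  assumes "P \<in> carrier_mat n m" "w \<in> carrier_vec n" "k < m"
  shows "col (replace_col P w j) k = (if k = j then w else col P k)"
  using assms by (intro eq_vecI) (auto simp: replace_col_def)

lemma replace_col_GL:
  assumes P: "P \<in> GL_set n" and R: "R \<in> carrier_mat n n" "P * R = 1\<^sub>m n"
    and w: "w \<in> carrier_vec n" and j: "j < n" and nz: "row R j \<bullet> w \<noteq> 0"
  shows "replace_col P w j \<in> GL_set n"
proof -
  note cP = GL_set_carrier[OF P]
  have "P *\<^sub>v (R *\<^sub>v w) = w" using cP R w by (simp flip: assoc_mult_mat_vec)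
  then have "det (replace_col P w j) = (R *\<^sub>v w) $ j * det P"
    using cramer_lemma_mat[OF cP mult_mat_vec_carrier[OF R(1) w] j] by simp
  then show ?thesis using P R w j nz by (auto simp: GL_set_def)
qed

lemma mult_eq_mult_sign_mat_if_eigenvector_cols:
  assumes "X \<in> carrier_mat n n" "P \<in> carrier_mat n n"
    and eig: "\<And>j. j < n \<Longrightarrow> sign_eigenvector X (col P j)"
  shows "\<exists>S\<subseteq>{..<n}. X * P = P * sign_mat n S"
proof -
  define S where "S = {j\<in>{..<n}. X *\<^sub>v col P j \<noteq> col P j}"
  have "X * P = P * sign_mat n S"
  proof (rule eq_matI)
    fix i j assume "i < dim_row (P * sign_mat n S)" "j < dim_col (P * sign_mat n S)"
    then have ij: "i < n" "j < n" using assms by auto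
    have "X *\<^sub>v col P j = bool_sign (j \<in> S) \<cdot>\<^sub>v col P j"
      using eig[OF ij(2)] ij(2) by (auto simp: S_def bool_sign_def sign_eigenvector_def)
    from arg_cong[OF this, of "\<lambda>v. v $ i"]
    have "(X * P) $$ (i, j) = P $$ (i, j) * bool_sign (j \<in> S)"
      using ij assms by (simp add: mult.commute)
    then show "(X * P) $$ (i, j) = (P * sign_mat n S) $$ (i, j)"
      by (simp only: index_mult_sign_mat(1)[OF assms(2) ij])
  qed (use assms in auto)
  then show ?thesis by (intro exI[of _ S]) (auto simp: S_def)
qed

lemma finite_commuting_involutions_diagonalizable:
  fixes L :: "'a::field mat set"
  assumes char: "(2::'a) \<noteq> 0" and L: "finite L" "commuting_involutions n L"
  obtains P where "P \<in> GL_set n" and "\<And>X. X \<in> L \<Longrightarrow> \<exists>S\<subseteq>{..<n}. X * P = P * sign_mat n S"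
proof -
  have "\<exists>P\<in>GL_set n. \<forall>X\<in>L. \<forall>j<k. sign_eigenvector X (col P j)" if "k \<le> n" for k
    using that
  proof (induction k)
    case 0
    then show ?case using GL_set_one by auto
  next
    case (Suc k)
    then obtain P where P: "P \<in> GL_set n"
      and eig: "\<And>X j. X \<in> L \<Longrightarrow> j < k \<Longrightarrow> sign_eigenvector X (col P j)" by force
    obtain R where R: "R \<in> GL_set n" "P * R = 1\<^sub>m n" "R * P = 1\<^sub>m n"
      using GL_set_inverse[OF P] by metis
    note carriers = GL_set_carrier[OF P] GL_set_carrier[OF R(1)]
    have k: "k < n" using Suc.prems by simp
    have "row R k \<bullet> col P k = (R * P) $$ (k, k)" using carriers k by simp
    then have "row R k \<bullet> col P k \<noteq> 0" using R k by simp
    then obtain w where w: "w \<in> carrier_vec n" "row R k \<bullet> w \<noteq> 0"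
      and eig_w: "\<And>X. X \<in> L \<Longrightarrow> sign_eigenvector X w"
      using commuting_involutions_common_eigenvector[OF char L, of "row R k" "col P k"] carriers k
      by auto
    have "sign_eigenvector X (col (replace_col P w k) j)"
      if "X \<in> L" "j < Suc k" for X j
      using that k eig eig_w by (auto simp: col_replace_col[OF carriers(1) w(1)] less_Suc_eq)
    then show ?case using replace_col_GL[OF P carriers(2) R(2) w(1) k w(2)] by blast
  qed
  from this[of n] obtain P where P: "P \<in> GL_set n"
    and eig: "\<And>X j. X \<in> L \<Longrightarrow> j < n \<Longrightarrow> sign_eigenvector X (col P j)" by auto
  have "\<exists>S\<subseteq>{..<n}. X * P = P * sign_mat n S" if "X \<in> L" for X
    using L(2) that P eig
    by (intro mult_eq_mult_sign_mat_if_eigenvector_cols)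
      (auto simp: commuting_involutions_def GL_set_carrier)
  then show ?thesis using that P by blast
qed

lemma finite_commuting_involutions:
  fixes L :: "'a::field mat set"
  assumes char: "(2::'a) \<noteq> 0" and L: "commuting_involutions n L"
  shows "finite L"
proof -
  have "card M \<le> 2 ^ n" if M: "M \<subseteq> L" "finite M" for M
  proof -
    obtain P where P: "P \<in> GL_set n"
      and diag: "\<And>X. X \<in> M \<Longrightarrow> \<exists>S\<subseteq>{..<n}. X * P = P * sign_mat n S"
      by (rule finite_commuting_involutions_diagonalizable[OF char M(2)
            commuting_involutions_subset[OF L M(1)]]) blast
    obtain R where R: "R \<in> GL_set n" "P * R = 1\<^sub>m n" using GL_set_inverse[OF P] by metis
    have "M \<subseteq> (\<lambda>S. P * sign_mat n S * R) ` Pow {..<n}"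
    proof
      fix X assume X: "X \<in> M"
      then have "X \<in> carrier_mat n n" using M(1) L by (auto simp: commuting_involutions_def)
      then have "X = X * P * R" using R GL_set_carrier[OF P] GL_set_carrier[OF R(1)] by simp
      then show "X \<in> (\<lambda>S. P * sign_mat n S * R) ` Pow {..<n}" using diag[OF X] by force
    qed
    then have "card M \<le> card (Pow {..<n})" by (intro surj_card_le) auto
    then show ?thesis by (simp add: card_Pow)
  qed
  then show ?thesis using finite_if_finite_subsets_card_bdd by blast
qed

lemma commuting_involutions_diagonalizable:
  fixes L :: "'a::field mat set"
  assumes "(2::'a) \<noteq> 0" "commuting_involutions n L"
  obtains P where "P \<in> GL_set n" and "\<And>X. X \<in> L \<Longrightarrow> \<exists>S\<subseteq>{..<n}. X * P = P * sign_mat n S"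
  using finite_commuting_involutions_diagonalizable[OF assms(1)
      finite_commuting_involutions[OF assms] assms(2)]
  by blast

subsection \<open>An element of the centralizer outside the identity component\<close>

definition perm_mat :: "nat \<Rightarrow> (nat \<Rightarrow> nat) \<Rightarrow> 'a::field mat" where
  "perm_mat n p = mat n n (\<lambda>(i, j). 1\<^sub>m n $$ (p i, j))"

lemma perm_mat_carrier [simp]: "perm_mat n p \<in> carrier_mat n n"
  by (simp add: perm_mat_def)

lemma perm_mat_dim [simp]: "dim_row (perm_mat n p) = n" "dim_col (perm_mat n p) = n"
  by (simp_all add: perm_mat_def)

lemma perm_mat_GL:
  assumes "p permutes {..<n}"
  shows "perm_mat n p \<in> (GL_set n :: 'a::field mat set)"
  using assms det_permute_rows[of "1\<^sub>m n :: 'a mat" n p]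
  by (simp add: perm_mat_def GL_set_def atLeast0LessThan sign_def)

lemma perm_mat_mult_sign_mat:
  assumes p: "p permutes {..<n}" and translate: "\<And>i. i < n \<Longrightarrow> p i \<in> S \<longleftrightarrow> (i \<in> S) \<noteq> q"
  shows "perm_mat n p * sign_mat n S
    = bool_sign q \<cdot>\<^sub>m (sign_mat n S * perm_mat n p :: 'a::field mat)"
proof (rule eq_matI)
  fix i j
  assume "i < dim_row (bool_sign q \<cdot>\<^sub>m (sign_mat n S * perm_mat n p :: 'a mat))"
    and "j < dim_col (bool_sign q \<cdot>\<^sub>m (sign_mat n S * perm_mat n p :: 'a mat))"
  then have ij: "i < n" "j < n" by simp_all
  have "perm_mat n p $$ (i, j) * bool_sign (j \<in> S)
      = bool_sign q * (bool_sign (i \<in> S) * (perm_mat n p $$ (i, j) :: 'a))"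
    using ij translate[OF ij(1)] permutes_in_image[OF p, of i]
    by (auto simp: perm_mat_def bool_sign_def)
  then show "(perm_mat n p * sign_mat n S) $$ (i, j)
      = (bool_sign q \<cdot>\<^sub>m (sign_mat n S * perm_mat n p :: 'a mat)) $$ (i, j)"
    using ij by (simp add: index_mult_sign_mat del: index_mult_mat(1))
qed simp_all

definition sign_code :: "nat \<Rightarrow> 'a::field mat \<Rightarrow> 'a mat set \<Rightarrow> nat set set" where
  "sign_code n P L = {S. S \<subseteq> {..<n} \<and> (\<exists>A\<in>L. A * P = P * sign_mat n S)}"

lemma sign_code_sym_diff_closed:
  assumes L: "L \<subseteq> carrier_mat n n" "\<And>A B. A \<in> L \<Longrightarrow> B \<in> L \<Longrightarrow> A * B \<in> L"
    and P: "P \<in> carrier_mat n n"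
  shows "sym_diff_closed (sign_code n P L)"
  unfolding sym_diff_closed_def
proof (intro ballI)
  fix S T assume ST: "S \<in> sign_code n P L" "T \<in> sign_code n P L"
  then obtain A B where AB: "A \<in> L" "B \<in> L"
    and diag: "A * P = P * sign_mat n S" "B * P = P * sign_mat n T"
    by (auto simp: sign_code_def)
  have carriers: "A \<in> carrier_mat n n" "B \<in> carrier_mat n n" using AB L(1) by auto
  have "A * B * P = A * (P * sign_mat n T)"
    using carriers P by (simp add: square_mat_simps[where n = n] diag)
  also have "\<dots> = (A * P) * sign_mat n T"
    using carriers P by (simp add: square_mat_simps[where n = n])
  also have "\<dots> = P * (sign_mat n S * sign_mat n T)"
    unfolding diag(1) using P by (simp add: square_mat_simps[where n = n])
  finally have "A * B * P = P * sign_mat n (sym_diff S T)" unfolding sign_mat_mult .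
  moreover have "sym_diff S T \<subseteq> {..<n}" using ST by (auto simp: sign_code_def)
  ultimately show "sym_diff S T \<in> sign_code n P L"
    using L(2)[OF AB] unfolding sign_code_def by blast
qed

lemma proj_class_eq_one_iff_sign_mat:
  assumes char: "(2::'a::field) \<noteq> 0" and P: "P \<in> GL_set n" and A: "A \<in> carrier_mat n n"
    and S: "S \<subseteq> {..<n}" and diag: "A * P = P * (sign_mat n S :: 'a mat)"
  shows "proj_class A = proj_class (1\<^sub>m n) \<longleftrightarrow> S = {} \<or> S = {..<n}"
proof
  note carrier_P = GL_set_carrier[OF P]
  have scalar_iff: "A = c \<cdot>\<^sub>m 1\<^sub>m n \<longleftrightarrow> sign_mat n S = c \<cdot>\<^sub>m (1\<^sub>m n :: 'a mat)" for c
  proof -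
    have "A = c \<cdot>\<^sub>m 1\<^sub>m n \<longleftrightarrow> A * P = (c \<cdot>\<^sub>m 1\<^sub>m n) * P"
      using A by (simp add: GL_set_mult_right_cancel[OF P])
    also have "(c \<cdot>\<^sub>m 1\<^sub>m n) * P = P * (c \<cdot>\<^sub>m 1\<^sub>m n)"
      using carrier_P by (simp add: square_mat_simps[where n = n])
    finally show ?thesis unfolding diag by (simp add: GL_set_mult_left_cancel[OF P])
  qed
  show "S = {} \<or> S = {..<n}" if "proj_class A = proj_class (1\<^sub>m n)"
    using that sign_mat_eq_smult_one_imp[OF char S] by (auto simp: proj_class_eq_iff scalar_iff)
  show "proj_class A = proj_class (1\<^sub>m n)" if "S = {} \<or> S = {..<n}"
    using that scalar_iff[of 1] scalar_iff[of "-1"]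
    by (auto simp: sign_mat_empty sign_mat_full proj_class_smult)
qed

lemma sign_code_balanced:
  fixes L :: "'a::field mat set"
  assumes char: "(2::'a) \<noteq> 0" and P: "P \<in> GL_set n" and L: "L \<subseteq> carrier_mat n n"
    and balanced: "\<And>A. A \<in> L \<Longrightarrow> proj_class A \<noteq> proj_class (1\<^sub>m n) \<Longrightarrow> projectively_balanced n A"
    and S: "S \<in> sign_code n P L" "S \<noteq> {}" "S \<noteq> {..<n}"
  shows "2 * card S = n"
proof -
  obtain A where A: "A \<in> L" "A * P = P * sign_mat n S" and S_sub: "S \<subseteq> {..<n}"
    using S(1) by (auto simp: sign_code_def)
  have carrier_A: "A \<in> carrier_mat n n" using A(1) L by blast
  have "proj_class A \<noteq> proj_class (1\<^sub>m n)"
    using proj_class_eq_one_iff_sign_mat[OF char P carrier_A S_sub A(2)] S by blast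
  then show ?thesis
    using projectively_balanced_card[OF char carrier_A balanced P S_sub A(2)] A(1) by blast
qed

lemma sign_code_ex_translation:
  fixes L :: "'a::field mat set"
  assumes char: "(2::'a) \<noteq> 0" and P: "P \<in> GL_set n"
    and L: "L \<subseteq> carrier_mat n n" "\<And>A B. A \<in> L \<Longrightarrow> B \<in> L \<Longrightarrow> A * B \<in> L"
    and balanced: "\<And>A. A \<in> L \<Longrightarrow> proj_class A \<noteq> proj_class (1\<^sub>m n) \<Longrightarrow> projectively_balanced n A"
    and ab: "a < n" "b < n"
  obtains p where "p permutes {..<n}"
    and "\<And>i S. i < n \<Longrightarrow> S \<in> sign_code n P L \<Longrightarrow> p i \<in> S \<longleftrightarrow> (i \<in> S) \<noteq> ((a \<in> S) \<noteq> (b \<in> S))"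
proof (rule code_translation_permutation[of "{..<n}" "sign_code n P L" "\<lambda>S. (a \<in> S) \<noteq> (b \<in> S)"])
  show "sym_diff_closed (sign_code n P L)"
    by (rule sign_code_sym_diff_closed[OF L GL_set_carrier[OF P]])
  show "parity_character (sign_code n P L) (\<lambda>S. (a \<in> S) \<noteq> (b \<in> S))"
    by (intro parity_character_neq parity_character_mem)
  show "2 * card S = card {..<n}" if "S \<in> sign_code n P L" "(a \<in> S) \<noteq> (b \<in> S)" for S
    using sign_code_balanced[OF char P L(1) balanced that(1)] that(2) ab by auto
qed (use that in \<open>auto simp: sign_code_def\<close>)

lemma conjugate_perm_mat_mult:
  assumes P: "P \<in> GL_set n" and R: "R \<in> GL_set n" "R * P = 1\<^sub>m n"
    and p: "p permutes {..<n}" and A: "A \<in> carrier_mat n n" "A * P = P * sign_mat n S"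
    and translate: "\<And>i. i < n \<Longrightarrow> p i \<in> S \<longleftrightarrow> (i \<in> S) \<noteq> q"
  shows "(P * perm_mat n p * R) * A = bool_sign q \<cdot>\<^sub>m (A * (P * perm_mat n p * R))"
proof -
  define g where "g = P * perm_mat n p * R"
  have g: "g \<in> GL_set n" unfolding g_def using P R p by (intro GL_set_mult perm_mat_GL)
  note carriers = A(1) GL_set_carrier[OF P] GL_set_carrier[OF R(1)] GL_set_carrier[OF g]
  have gP: "g * P = P * perm_mat n p"
    unfolding g_def using carriers R(2)
    by (simp add: square_mat_simps[where n = n] right_mult_one_mat[of _ n n])
  have "g * A * P = (g * P) * sign_mat n S"
    using carriers A(2) by (simp add: square_mat_simps[where n = n])
  also have "\<dots> = bool_sign q \<cdot>\<^sub>m ((A * P) * perm_mat n p)"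
    unfolding gP A(2) using carriers
    by (simp add: square_mat_simps[where n = n] perm_mat_mult_sign_mat[OF p translate])
  also have "(A * P) * perm_mat n p = A * g * P"
    using carriers gP by (simp add: square_mat_simps[where n = n])
  also have "bool_sign q \<cdot>\<^sub>m (A * g * P) = bool_sign q \<cdot>\<^sub>m (A * g) * P"
    using carriers by (simp add: square_mat_simps[where n = n])
  finally show ?thesis
    using carriers unfolding g_def[symmetric]
    by (subst (asm) GL_set_mult_right_cancel[OF P]) auto
qed

text \<open>In a common eigenbasis, take the permutation matrix that translates the code by the quotient
  of the characters of two coordinates separated by \<open>A\<close>.\<close>

lemma balanced_involutions_ex_anticommuting:
  fixes L :: "'a::field mat set"
  assumes char: "(2::'a) \<noteq> 0"
    and L: "commuting_involutions n L" "\<And>A B. A \<in> L \<Longrightarrow> B \<in> L \<Longrightarrow> A * B \<in> L"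
    and balanced: "\<And>A. A \<in> L \<Longrightarrow> proj_class A \<noteq> proj_class (1\<^sub>m n) \<Longrightarrow> projectively_balanced n A"
    and A: "A \<in> L" "proj_class A \<noteq> proj_class (1\<^sub>m n)"
  obtains g where "g \<in> GL_set n" "g * A = (-1) \<cdot>\<^sub>m (A * g)"
    and "\<And>B. B \<in> L \<Longrightarrow> \<exists>c. c \<noteq> 0 \<and> g * B = c \<cdot>\<^sub>m (B * g)"
proof -
  have carrier_L: "L \<subseteq> carrier_mat n n" using L(1) by (auto simp: commuting_involutions_def)
  obtain P where P: "P \<in> GL_set n"
    and diag: "\<And>B. B \<in> L \<Longrightarrow> \<exists>S\<subseteq>{..<n}. B * P = P * sign_mat n S"
    by (rule commuting_involutions_diagonalizable[OF char L(1)]) blast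
  obtain R where R: "R \<in> GL_set n" "R * P = 1\<^sub>m n" using GL_set_inverse[OF P] by metis
  obtain S\<^sub>A where S\<^sub>A: "S\<^sub>A \<subseteq> {..<n}" "A * P = P * sign_mat n S\<^sub>A" using diag[OF A(1)] by blast
  then have "S\<^sub>A \<noteq> {}" "S\<^sub>A \<noteq> {..<n}"
    using proj_class_eq_one_iff_sign_mat[OF char P _ S\<^sub>A] A carrier_L by auto
  then obtain a b where ab: "a < n" "b < n" "a \<in> S\<^sub>A" "b \<notin> S\<^sub>A" using S\<^sub>A(1) by blast
  obtain p where p: "p permutes {..<n}" and translate: "\<And>i S. i < n \<Longrightarrow> S \<in> sign_code n P L \<Longrightarrow>
      p i \<in> S \<longleftrightarrow> (i \<in> S) \<noteq> ((a \<in> S) \<noteq> (b \<in> S))"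
    by (rule sign_code_ex_translation[OF char P carrier_L L(2) balanced ab(1,2)]) blast+
  define g where "g = P * perm_mat n p * R"
  have twist: "g * B = bool_sign ((a \<in> S) \<noteq> (b \<in> S)) \<cdot>\<^sub>m (B * g)"
    if B: "B \<in> L" and S: "S \<subseteq> {..<n}" "B * P = P * sign_mat n S" for B S
  proof -
    have "S \<in> sign_code n P L" using B S by (auto simp: sign_code_def)
    then show ?thesis
      unfolding g_def using translate B carrier_L
      by (intro conjugate_perm_mat_mult[OF P R p _ S(2)]) auto
  qed
  have "g \<in> GL_set n" unfolding g_def using P R p by (intro GL_set_mult perm_mat_GL)
  moreover have "g * A = (-1) \<cdot>\<^sub>m (A * g)" using twist[OF A(1) S\<^sub>A] ab by simp
  moreover have "\<exists>c. c \<noteq> 0 \<and> g * B = c \<cdot>\<^sub>m (B * g)" if B: "B \<in> L" for B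
  proof -
    obtain S where "S \<subseteq> {..<n}" "B * P = P * sign_mat n S" using diag[OF B] by blast
    from twist[OF B this] show ?thesis using bool_sign_nonzero by blast
  qed
  ultimately show ?thesis by (rule that)
qed

definition involutive_lifts :: "nat \<Rightarrow> 'a::field mat set set \<Rightarrow> 'a mat set" where
  "involutive_lifts n D = {A \<in> GL_set n. A * A = 1\<^sub>m n \<and> proj_class A \<in> D}"

lemma commuting_involutions_involutive_lifts:
  fixes D :: "'a::field mat set set"
  assumes char: "(2::'a) \<noteq> 0" and n: "n > 0" and T: "PGL_torus n T" "D \<subseteq> T"
  shows "commuting_involutions n (involutive_lifts n D)"
proof -
  have T_sub: "subgroup T (PGL n)" and T_conn: "PGL_connected n T"
    and T_comm: "\<And>x y. x \<in> T \<Longrightarrow> y \<in> T \<Longrightarrow> x \<otimes>\<^bsub>PGL n\<^esub> y = y \<otimes>\<^bsub>PGL n\<^esub> x"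
    using T(1) by (auto simp: PGL_torus_def)
  have "A * B = B * A" if A: "A \<in> involutive_lifts n D" and B: "B \<in> involutive_lifts n D" for A B
  proof (rule PGL_connected_commuting_lifts[OF char n T_conn])
    show "T \<subseteq> PGL_centralizer n {proj_class B}"
      using subgroup.subset[OF T_sub] T_comm T(2) B
      by (auto simp: PGL_centralizer_def involutive_lifts_def)
  qed (use A B T(2) subgroup.one_closed[OF T_sub] in
      \<open>auto simp: involutive_lifts_def GL_set_carrier\<close>)
  then show ?thesis
    by (auto simp: commuting_involutions_def involutive_lifts_def GL_set_carrier)
qed

lemma involutive_lifts_mult:
  assumes D: "subgroup D (PGL n)" and L: "commuting_involutions n (involutive_lifts n D)"
    and A: "A \<in> involutive_lifts n D" and B: "B \<in> involutive_lifts n D"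
  shows "A * B \<in> involutive_lifts n D"
proof -
  have carriers: "A \<in> carrier_mat n n" "B \<in> carrier_mat n n"
    and squares: "A * A = 1\<^sub>m n" "B * B = 1\<^sub>m n" and comm: "B * A = A * B"
    using L A B by (auto simp: commuting_involutions_def)
  have "(A * B) * (A * B) = A * (B * A) * B"
    using carriers by (simp add: square_mat_simps[where n = n])
  also have "\<dots> = (A * A) * (B * B)"
    unfolding comm using carriers by (simp add: square_mat_simps[where n = n])
  finally have "(A * B) * (A * B) = 1\<^sub>m n" using squares by simp
  moreover have "proj_class (A * B) \<in> D"
    using subgroup.m_closed[OF D] A B
    by (auto simp: involutive_lifts_def simp flip: PGL_mult[OF carriers])
  ultimately show ?thesis using A B by (auto simp: involutive_lifts_def intro: GL_set_mult)
qed

lemma similar_smult_involution_square: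
  fixes A E :: "'a::field mat"
  assumes A: "A \<in> carrier_mat n n" and E: "E \<in> carrier_mat n n" "E * E = 1\<^sub>m n"
    and sim: "similar_mat A (c \<cdot>\<^sub>m E)"
  shows "A * A = (c * c) \<cdot>\<^sub>m 1\<^sub>m n"
proof -
  obtain P where P: "P \<in> GL_set n" and AP: "A * P = P * (c \<cdot>\<^sub>m E)"
    by (rule similar_mat_intertwiner[OF sim A])
  note carriers = A E(1) GL_set_carrier[OF P]
  have AP': "A * P = c \<cdot>\<^sub>m (P * E)" using AP carriers by (simp add: square_mat_simps[where n = n])
  have "A * A * P = A * (A * P)" using carriers by simp
  also have "\<dots> = c \<cdot>\<^sub>m ((A * P) * E)"
    using carriers by (subst AP') (simp add: square_mat_simps[where n = n])
  also have "\<dots> = (c * c) \<cdot>\<^sub>m (P * (E * E))"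
    unfolding AP' using carriers by (simp add: square_mat_simps[where n = n])
  also have "\<dots> = (c * c) \<cdot>\<^sub>m 1\<^sub>m n * P"
    using carriers E(2) by (simp add: square_mat_simps[where n = n])
  finally show ?thesis using carriers by (subst (asm) GL_set_mult_right_cancel[OF P]) auto
qed

lemma ex_involutive_lift:
  fixes E :: "'a::field mat"
  assumes x: "x \<in> D" "x \<in> carrier (PGL n)"
    and E: "E \<in> GL_set n" "E * E = 1\<^sub>m n" and conj: "conjugate_in (PGL n) x (proj_class E)"
  shows "\<exists>A\<in>involutive_lifts n D. proj_class A = x"
proof -
  obtain X where X: "X \<in> GL_set n" "x = proj_class X" using x(2) by (auto simp: PGL_carrier)
  obtain c where c: "c \<noteq> 0" "similar_mat X (c \<cdot>\<^sub>m E)"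
    using conjugate_in_PGL_imp_similar[OF X(1) E(1)] conj X(2) by blast
  have "X * X = (c * c) \<cdot>\<^sub>m 1\<^sub>m n"
    using similar_smult_involution_square[OF _ _ E(2) c(2)] X E by (simp add: GL_set_carrier)
  then have "(1 / c) \<cdot>\<^sub>m X * ((1 / c) \<cdot>\<^sub>m X) = 1\<^sub>m n"
    using X(1) c(1) by (simp add: square_mat_simps[where n = n] GL_set_carrier)
  moreover have "proj_class ((1 / c) \<cdot>\<^sub>m X) = x" using X(2) c(1) by (simp add: proj_class_smult)
  ultimately show ?thesis
    using X(1) c(1) x(1)
    by (intro bexI[of _ "(1 / c) \<cdot>\<^sub>m X"]) (simp_all add: involutive_lifts_def GL_set_smult)
qed

lemma PGL_identity_component_centralizer_commutes:
  fixes A B :: "'a::field mat"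
  assumes char: "(2::'a) \<noteq> 0" and n: "n > 0" and A: "A \<in> involutive_lifts n D"
    and B: "B \<in> carrier_mat n n" "proj_class B \<in> PGL_identity_component n (PGL_centralizer n D)"
  shows "B * A = A * B"
proof -
  obtain S where S: "S \<subseteq> PGL_centralizer n D" "\<one>\<^bsub>PGL n\<^esub> \<in> S"
    "PGL_connected n S" "proj_class B \<in> S"
    using B(2) by (auto simp: PGL_identity_component_def)
  then have "S \<subseteq> PGL_centralizer n {proj_class A}"
    using A by (auto simp: PGL_centralizer_def involutive_lifts_def)
  then show ?thesis
    using PGL_connected_commuting_lifts[OF char n S(3) _ S(2) _ _ B(1) S(4)] A
    by (simp add: involutive_lifts_def)
qed

lemma proj_class_mem_PGL_centralizer:
  assumes g: "g \<in> GL_set n"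
    and lift: "\<And>x. x \<in> D \<Longrightarrow> x \<noteq> \<one>\<^bsub>PGL n\<^esub> \<Longrightarrow> \<exists>A\<in>L. proj_class A = x"
    and L: "L \<subseteq> GL_set n" "\<And>A. A \<in> L \<Longrightarrow> \<exists>c. c \<noteq> 0 \<and> g * A = c \<cdot>\<^sub>m (A * g)"
  shows "proj_class g \<in> PGL_centralizer n D"
proof -
  have "proj_class g \<otimes>\<^bsub>PGL n\<^esub> x = x \<otimes>\<^bsub>PGL n\<^esub> proj_class g" if x: "x \<in> D" for x
  proof (cases "x = \<one>\<^bsub>PGL n\<^esub>")
    case True
    then show ?thesis using GL_set_carrier[OF g] by (simp add: PGL_one PGL_mult)
  next
    case False
    then obtain A where A: "A \<in> L" "x = proj_class A" using lift[OF x] by blast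
    then show ?thesis using L PGL_commute_iff[OF g] by blast
  qed
  then show ?thesis using g by (auto simp: PGL_centralizer_def PGL_carrier)
qed

lemma torus_balanced_ex_anticommuting_centralizer:
  fixes D :: "'a::field mat set set"
  assumes char: "(2::'a) \<noteq> 0" and n: "n > 0"
    and D: "subgroup D (PGL n)" "D \<noteq> {\<one>\<^bsub>PGL n\<^esub>}" and torus: "PGL_torus n H" "D \<subseteq> H"
    and T: "T \<subseteq> {..<n}" "2 * card T = n"
    and conj: "\<And>x. x \<in> D \<Longrightarrow> x \<noteq> \<one>\<^bsub>PGL n\<^esub> \<Longrightarrow> conjugate_in (PGL n) x (proj_class (sign_mat n T))"
  obtains g A where "g \<in> GL_set n" "proj_class g \<in> PGL_centralizer n D"
    and "A \<in> involutive_lifts n D" "g * A = (-1) \<cdot>\<^sub>m (A * g)"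
proof -
  let ?L = "involutive_lifts n D"
  have L: "commuting_involutions n ?L"
    by (rule commuting_involutions_involutive_lifts[OF char n torus])
  have lift: "\<exists>A\<in>?L. proj_class A = x" if "x \<in> D" "x \<noteq> \<one>\<^bsub>PGL n\<^esub>" for x
    using ex_involutive_lift[OF that(1) _ sign_mat_GL sign_mat_square conj[OF that]]
      subgroup.mem_carrier[OF D(1) that(1)] by blast
  have balanced: "projectively_balanced n A"
    if A: "A \<in> ?L" "proj_class A \<noteq> proj_class (1\<^sub>m n)" for A
  proof -
    have "A \<in> GL_set n" "proj_class A \<in> D" using A(1) by (auto simp: involutive_lifts_def)
    then obtain c where "similar_mat A (c \<cdot>\<^sub>m sign_mat n T)"
      using conjugate_in_PGL_imp_similar[OF _ sign_mat_GL conj] A(2) by (metis PGL_one)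
    then show ?thesis using T by (auto simp: projectively_balanced_def)
  qed
  obtain A where A: "A \<in> ?L" "proj_class A \<noteq> proj_class (1\<^sub>m n)"
    using lift D(2) subgroup.one_closed[OF D(1)] unfolding PGL_one by blast
  obtain g where g: "g \<in> GL_set n" "g * A = (-1) \<cdot>\<^sub>m (A * g)"
    and scaled: "\<And>B. B \<in> ?L \<Longrightarrow> \<exists>c. c \<noteq> 0 \<and> g * B = c \<cdot>\<^sub>m (B * g)"
    using balanced_involutions_ex_anticommuting[OF char L
        involutive_lifts_mult[OF D(1) L] balanced A]
    by blast
  have "proj_class g \<in> PGL_centralizer n D"
    by (rule proj_class_mem_PGL_centralizer[OF g(1) lift _ scaled])
      (auto simp: involutive_lifts_def)
  then show ?thesis using that g A(1) by blast
qed

lemma e_elem_eq: "e_elem n k = proj_class (sign_mat n {..<k})"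
  unfolding e_elem_def sign_mat_def mat_diag_def
  by (intro arg_cong[where f = proj_class] eq_matI) (auto simp: bool_sign_def)

theorem theorem4p12:
  fixes n :: nat and D :: "'a::field mat set set"
  assumes "alg_closed_field TYPE('a)"
    and "(2::'a) \<noteq> 0"
    and "n \<ge> 2" and "even n"
    and "elem_abelian_2_subgroup (PGL n) D"
    and "D \<noteq> {\<one>\<^bsub>PGL n\<^esub>}"
    and "PGL_toral n D"
    and "PGL_centralizer n D = PGL_identity_component n (PGL_centralizer n D)"
  shows "\<exists>x\<in>D. x \<noteq> \<one>\<^bsub>PGL n\<^esub> \<and> \<not> conjugate_in (PGL n) x (e_elem n (n div 2))"
proof (rule ccontr)
  assume "\<not> ?thesis"
  then have conj: "conjugate_in (PGL n) x (proj_class (sign_mat n {..<n div 2}))"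
    if "x \<in> D" "x \<noteq> \<one>\<^bsub>PGL n\<^esub>" for x
    using that by (auto simp: e_elem_eq)
  have n: "n > 0" "2 * card {..<n div 2} = n" using assms(3,4) by auto
  have D: "subgroup D (PGL n)" using assms(5) by (simp add: elem_abelian_2_subgroup_def)
  obtain H where H: "PGL_torus n H" "D \<subseteq> H"
    using assms(7) by (auto simp: PGL_toral_def PGL_maximal_torus_def)
  obtain g A where g: "g \<in> GL_set n" "proj_class g \<in> PGL_centralizer n D"
    and A: "A \<in> involutive_lifts n D" "g * A = (-1) \<cdot>\<^sub>m (A * g)"
    by (rule torus_balanced_ex_anticommuting_centralizer[OF assms(2) n(1) D assms(6) H _ n(2) conj])
      auto
  have "g * A = A * g"
    using PGL_identity_component_centralizer_commutes[OF assms(2) n(1) A(1)]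
      GL_set_carrier[OF g(1)] g(2) assms(8) by blast
  then have "1 \<cdot>\<^sub>m (A * g) = (-1) \<cdot>\<^sub>m (A * g)" using A(2) by simp
  moreover have "A * g \<in> GL_set n"
    using A(1) g(1) by (auto simp: involutive_lifts_def intro: GL_set_mult)
  ultimately show False
    using GL_set_smult_cancel[OF _ n(1)] one_neq_minus_one_iff assms(2) by blast
qed

end
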